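(* There exists an absolute constant $C$ such that for all integers $n\ge 2$ and $q\ge 0$: if the complete graph $K_n$ is terminal-pairable with respect to $K_n^{q}$ (that is, every demand multigraph $D$ on the vertex set $V(K_n)$ with maximum degree at most $q$ can be realized in $K_n$), then $$q\le \frac{13}{27}\,n + C.$$
   Context: $K_n$ denotes the complete simple graph on $n$ vertices. A demand multigraph for a simple graph $G$ is an undirected finite multigraph $D$ (parallel edges allowed, no loops) with $V(D)=V(G)$; its edges $e_1,\ldots,e_{|E(D)|}$, counted with multiplicity, are called demand edges. The degree of a vertex in $D$ is the number of demand edges incident to it, counted with multiplicity, and the maximum degree $\Delta(D)$ is the largest such degree. $D$ can be realized in $G$ if there exist pairwise edge-disjoint paths $P_1,\ldots,P_{|E(D)|}$ in $G$ such that $P_i$ joins the two endpoints of $e_i$ for every $i=1,\ldots,|E(D)|$ (the paths may share vertices). Given a family $\mathcal{F}$ of demand multigraphs on $V(G)$, $G$ is terminal-pairable with respect to $\mathcal{F}$ if every member of $\mathcal{F}$ can be realized in $G$. $K_n^{q}$ denotes the set of all demand multigraphs $D$ on the vertex set of $K_n$ with $\Delta(D)\le q$. *)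

theory Defs
  imports Complex_Main "HOL-Library.Multiset"
begin

text \<open>
  An undirected edge without loop is a two-element set of vertices. A simple graph is a pair
  of a vertex set and an edge set. All demand multigraphs for a graph share its vertex set,
  so a demand multigraph is given by its multiset of edges alone, and the vertex set is passed
  as a parameter where it is needed.
\<close>

type_synonym 'a ugraph = "'a set \<times> 'a set set"

definition all_edges :: "'a set \<Rightarrow> 'a set set" where
  "all_edges V = {e. e \<subseteq> V \<and> card e = 2}"

definition complete_graph :: "nat \<Rightarrow> nat ugraph" where
  "complete_graph n = ({..<n}, all_edges {..<n})"

definition demand_multigraphs :: "'a set \<Rightarrow> 'a set multiset set" where
  "demand_multigraphs V = {D. set_mset D \<subseteq> all_edges V}"

definition degree :: "'a set multiset \<Rightarrow> 'a \<Rightarrow> nat" where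
  "degree D v = size {#e \<in># D. v \<in> e#}"

text \<open>Meaningful only for finite nonempty \<open>V\<close>.\<close>

definition max_degree :: "'a set \<Rightarrow> 'a set multiset \<Rightarrow> nat" where
  "max_degree V D = Max (degree D ` V)"

definition path_edges :: "'a list \<Rightarrow> 'a set set" where
  "path_edges p = {{p ! i, p ! Suc i} | i. Suc i < length p}"

definition is_path :: "'a ugraph \<Rightarrow> 'a list \<Rightarrow> bool" where
  "is_path G p \<longleftrightarrow> p \<noteq> [] \<and> distinct p \<and> set p \<subseteq> fst G \<and> path_edges p \<subseteq> snd G"

text \<open>
  The list \<open>es\<close> enumerates the demand edges with multiplicity; the choice of enumeration
  is irrelevant, since the paths can be permuted along with the demand edges.
\<close>

definition realizable :: "'a ugraph \<Rightarrow> 'a set multiset \<Rightarrow> bool" where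
  "realizable G D \<longleftrightarrow>
     (\<exists>es Ps. mset es = D \<and> length Ps = length es \<and>
        (\<forall>i < length es. is_path G (Ps ! i) \<and> {hd (Ps ! i), last (Ps ! i)} = es ! i) \<and>
        (\<forall>i < length es. \<forall>j < length es. i \<noteq> j \<longrightarrow>
            path_edges (Ps ! i) \<inter> path_edges (Ps ! j) = {}))"

definition terminal_pairable :: "'a ugraph \<Rightarrow> 'a set multiset set \<Rightarrow> bool" where
  "terminal_pairable G \<F> \<longleftrightarrow> (\<forall>D \<in> \<F>. realizable G D)"

text \<open>The family \<open>K\<^sub>n\<^sup>q\<close>.\<close>

definition bounded_demands :: "nat \<Rightarrow> nat \<Rightarrow> nat set multiset set" where
  "bounded_demands n q =
     {D \<in> demand_multigraphs (fst (complete_graph n)). max_degree (fst (complete_graph n)) D \<le> q}"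

end

theory Submission
  imports Defs "HOL-Library.Disjoint_Sets"
begin

text \<open>
  The obstruction is the demand multigraph that consists of \<open>m = n div 3\<close> disjoint triangles,
  every edge taken with multiplicity \<open>k = q div 2\<close>. Its maximum degree is at most \<open>q\<close> and it
  has \<open>3 * m * k\<close> edges, about \<open>n * q / 2\<close> of them.

  Only \<open>O(n)\<close> edges of the complete graph lie inside a triangle or touch one of the at most two
  remaining vertices, so all but \<open>O(n)\<close> of the edge-disjoint paths of a realization use only
  crossing edges, that is, edges between different triangles. As the ends of a path lie
  in the same triangle, such a path has at least two edges. Counting edges with this bound alone
  gives \<open>q \<le> n / 2 + O(1)\<close>; the gain comes from parity. A crossing path with exactly two edges
  goes from its triangle \<open>S\<close> to a vertex of another triangle \<open>T\<close> and back to \<open>S\<close>, so both of its edges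
  are among the nine edges between \<open>S\<close> and \<open>T\<close>. Nine is odd, hence a pair of triangles carries at
  most four such paths, and at least one of the nine edges is left to paths with at least three edges.

  With \<open>M = m choose 2\<close> pairs of triangles, let \<open>a\<close> be the number of crossing paths with
  two edges and \<open>b\<close> the number of longer ones. Then \<open>a \<le> 4 * M\<close> and \<open>2 * a + 3 * b \<le> 9 * M\<close>, which sum to \<open>3 * (a + b) \<le> 13 * M\<close>.
  So \<open>3 * m * k\<close> is at most \<open>13 / 6 * m\<^sup>2 + O(n)\<close>, and therefore \<open>q\<close> is at most
  \<open>13 / 9 * m + O(1) = 13 / 27 * n + O(1)\<close>. The lemmas \<open>crossing_two_path\<close> and
  \<open>card_edges_across\<close> supply the parity argument, and \<open>triangle_demand_bound\<close> does the counting.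
\<close>

section \<open>Paths\<close>

lemma path_edges_Cons:
  "path_edges (x # y # p) = insert {x, y} (path_edges (y # p))"
proof -
  have "path_edges (x # y # p) =
      (\<lambda>i. {(x # y # p) ! i, (x # y # p) ! Suc i}) ` {i. i < Suc (length p)}"
    by (auto simp: path_edges_def)
  also have "{i. i < Suc (length p)} = insert 0 (Suc ` {i. i < length p})"
    by (auto simp: less_Suc_eq_0_disj)
  also have "(\<lambda>i. {(x # y # p) ! i, (x # y # p) ! Suc i}) ` \<dots> = insert {x, y} (path_edges (y # p))"
    by (auto simp: path_edges_def image_image)
  finally show ?thesis .
qed

lemma path_edges_singleton: "path_edges [x] = {}"
  by (simp add: path_edges_def)

lemma path_edges_subset_vertices: "e \<in> path_edges p \<Longrightarrow> e \<subseteq> set p"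
  by (auto simp: path_edges_def)

lemma finite_path_edges: "finite (path_edges p)"
  by (rule finite_subset[of _ "Pow (set p)"]) (auto dest: path_edges_subset_vertices)

lemma card_path_edges: "distinct p \<Longrightarrow> card (path_edges p) = length p - 1"
proof (induction p rule: induct_list012)
  case (3 x y zs)
  have "{x, y} \<notin> path_edges (y # zs)"
    using 3(3) path_edges_subset_vertices[of "{x, y}" "y # zs"] by auto
  then show ?case
    using 3 by (simp add: path_edges_Cons finite_path_edges)
qed (simp_all add: path_edges_singleton, simp add: path_edges_def)

text \<open>
  Demand edges are addressed by their positions in an enumeration, so that parallel edges
  stay separate and the counting below is done with functions on an initial segment of the
  natural numbers.
\<close>

lemma realizableE:
  assumes "realizable G D"
  obtains p where
    "\<And>i. i < size D \<Longrightarrow> is_path G (p i)"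
    "\<And>i. i < size D \<Longrightarrow> {hd (p i), last (p i)} \<in># D"
    "disjoint_family_on (\<lambda>i. path_edges (p i)) {..<size D}"
proof -
  obtain es Ps where *: "mset es = D" "length Ps = length es"
    "\<forall>i < length es. is_path G (Ps ! i) \<and> {hd (Ps ! i), last (Ps ! i)} = es ! i"
    "\<forall>i < length es. \<forall>j < length es. i \<noteq> j \<longrightarrow> path_edges (Ps ! i) \<inter> path_edges (Ps ! j) = {}"
    using assms unfolding realizable_def by blast
  have len: "size D = length es"
    using *(1) by auto
  show ?thesis
  proof (rule that[of "\<lambda>i. Ps ! i"])
    show "{hd (Ps ! i), last (Ps ! i)} \<in># D" if "i < size D" for i
      using that * len by (metis nth_mem set_mset_mset)
  qed (use * len in \<open>auto simp: disjoint_family_on_def\<close>)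
qed

lemma sum_card_disjoint_le:
  assumes "disjoint_family_on E I" "finite I" "finite X"
    and "\<And>i. i \<in> I \<Longrightarrow> E i \<subseteq> X"
  shows "(\<Sum>i\<in>I. card (E i)) \<le> card X"
proof -
  have "(\<Sum>i\<in>I. card (E i)) = card (\<Union>i\<in>I. E i)"
    using assms finite_subset[OF assms(4) assms(3)]
    by (intro card_UN_disjoint[symmetric]) (auto simp: disjoint_family_on_def)
  also have "\<dots> \<le> card X"
    using assms by (intro card_mono) auto
  finally show ?thesis .
qed

lemma finite_all_edges: "finite V \<Longrightarrow> finite (all_edges V)"
  by (auto simp: all_edges_def intro: finite_subset[of _ "Pow V"])

lemma card_all_edges: "finite V \<Longrightarrow> card (all_edges V) = card V choose 2"
  by (simp add: all_edges_def n_subsets)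

lemma realizable_size_le:
  assumes "realizable (V, A) D" "finite A" "\<And>e. e \<in># D \<Longrightarrow> card e = 2"
  shows "size D \<le> card A"
proof -
  obtain p where p: "\<And>i. i < size D \<Longrightarrow> is_path (V, A) (p i)"
    "\<And>i. i < size D \<Longrightarrow> {hd (p i), last (p i)} \<in># D"
    "disjoint_family_on (\<lambda>i. path_edges (p i)) {..<size D}"
    using realizableE[OF assms(1)] by blast
  have "card (path_edges (p i)) \<ge> 1" if i: "i < size D" for i
  proof -
    have "hd (p i) \<noteq> last (p i)"
      using assms(3)[OF p(2)[OF i]] by auto
    moreover have "p i \<noteq> []" "distinct (p i)"
      using p(1)[OF i] by (auto simp: is_path_def)
    ultimately have "length (p i) \<ge> 2"
      by (cases "p i" rule: remdups_adj.cases) auto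
    then show ?thesis
      using card_path_edges[OF \<open>distinct (p i)\<close>] by simp
  qed
  then have "(\<Sum>i<size D. 1) \<le> (\<Sum>i<size D. card (path_edges (p i)))"
    by (intro sum_mono) auto
  also have "\<dots> \<le> card A"
    using p assms by (intro sum_card_disjoint_le) (auto simp: is_path_def)
  finally show ?thesis by simp
qed

section \<open>Disjoint triangles and the edges between them\<close>

text \<open>
  The triangles are blocks of three consecutive numbers. The vertex sets of the triangles are
  thus the fibres of division by 3, and the image of an edge under this map is the set of the
  triangles that it meets: a singleton for an edge inside a triangle, a pair for a crossing edge.
\<close>

definition triangle :: "nat \<Rightarrow> nat set" where
  "triangle t = {v. v div 3 = t}"

definition triangle_edges :: "nat \<Rightarrow> nat set set" where
  "triangle_edges m = (\<Union>t<m. all_edges (triangle t))"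

definition edges_across :: "nat set \<Rightarrow> nat set set" where
  "edges_across P = {e. card e = 2 \<and> (\<lambda>v. v div 3) ` e = P}"

definition crossing_edges :: "nat \<Rightarrow> nat set set" where
  "crossing_edges m = (\<Union>P\<in>all_edges {..<m}. edges_across P)"

lemma triangle_eq: "triangle t = {3*t..<3*t+3}"
  by (auto simp: triangle_def)

lemma card_triangle: "card (triangle t) = 3" and finite_triangle: "finite (triangle t)"
  by (simp_all add: triangle_eq)

lemma triangle_edges_constant_div:
  "e \<in> triangle_edges m \<Longrightarrow> \<exists>t<m. (\<lambda>v. v div 3) ` e = {t}"
  by (fastforce simp: triangle_edges_def all_edges_def triangle_def card_2_iff)

lemma in_repeat_msetD: "x \<in># repeat_mset k M \<Longrightarrow> x \<in># M"
  by (metis count_repeat_mset mult_0_right not_in_iff)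

lemma finite_triangle_edges: "finite (triangle_edges m)"
  by (simp add: triangle_edges_def finite_all_edges finite_triangle)

lemma card_triangle_edges: "card (triangle_edges m) = 3 * m"
proof -
  have "card (triangle_edges m) = (\<Sum>t<m. card (all_edges (triangle t)))"
    unfolding triangle_edges_def
  proof (intro card_UN_disjoint ballI impI)
    show "all_edges (triangle s) \<inter> all_edges (triangle t) = {}" if "s \<noteq> t" for s t
      using that by (auto simp: all_edges_def triangle_def card_2_iff)
  qed (simp_all add: finite_all_edges finite_triangle)
  then show ?thesis
    by (simp add: card_all_edges finite_triangle card_triangle choose_two)
qed

lemma card_edges_across:
  assumes "s \<noteq> t"
  shows "card (edges_across {s, t}) = 9"
proof -
  have "edges_across {s, t} = (\<lambda>(u, v). {u, v}) ` (triangle s \<times> triangle t)"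
  proof (intro equalityI subsetI)
    fix e assume "e \<in> edges_across {s, t}"
    then obtain a b where ab: "e = {a, b}" "{a div 3, b div 3} = {s, t}"
      by (auto simp: edges_across_def card_2_iff)
    then consider "a div 3 = s" "b div 3 = t" | "b div 3 = s" "a div 3 = t"
      by (metis doubleton_eq_iff)
    then show "e \<in> (\<lambda>(u, v). {u, v}) ` (triangle s \<times> triangle t)"
    proof cases
      case 1
      then show ?thesis
        using ab by (intro image_eqI[of _ _ "(a, b)"]) (auto simp: triangle_def)
    next
      case 2
      then show ?thesis
        using ab by (intro image_eqI[of _ _ "(b, a)"]) (auto simp: triangle_def)
    qed
  next
    fix e assume "e \<in> (\<lambda>(u, v). {u, v}) ` (triangle s \<times> triangle t)"
    then show "e \<in> edges_across {s, t}"
      using assms by (auto simp: edges_across_def triangle_def card_2_iff)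
  qed
  moreover have "inj_on (\<lambda>(u, v). {u, v}) (triangle s \<times> triangle t)"
    using assms by (auto simp: inj_on_def triangle_def doubleton_eq_iff)
  ultimately show ?thesis
    by (simp add: card_image card_cartesian_product card_triangle)
qed

lemma card_edges_across_pair: "P \<in> all_edges {..<m} \<Longrightarrow> card (edges_across P) = 9"
  by (auto simp: all_edges_def card_2_iff card_edges_across)

lemma finite_edges_across_pair: "P \<in> all_edges {..<m} \<Longrightarrow> finite (edges_across P)"
  using card_edges_across_pair by (metis card.infinite zero_neq_numeral)

lemma finite_crossing_edges: "finite (crossing_edges m)"
  by (auto simp: crossing_edges_def finite_all_edges finite_edges_across_pair)

lemma card_crossing_edges: "card (crossing_edges m) = 9 * (m choose 2)"
proof -
  have "card (crossing_edges m) = (\<Sum>P\<in>all_edges {..<m}. card (edges_across P))"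
    unfolding crossing_edges_def
    by (intro card_UN_disjoint)
       (auto simp: finite_all_edges finite_edges_across_pair, auto simp: edges_across_def)
  then show ?thesis
    by (simp add: card_edges_across_pair card_all_edges)
qed

lemma crossing_edges_subset:
  assumes "3 * m \<le> n"
  shows "crossing_edges m \<subseteq> all_edges {..<n}"
proof
  fix e assume "e \<in> crossing_edges m"
  then have e: "card e = 2" "(\<lambda>v. v div 3) ` e \<subseteq> {..<m}"
    by (auto simp: crossing_edges_def edges_across_def all_edges_def)
  have "v < n" if "v \<in> e" for v
  proof -
    have "v div 3 < m" using e(2) that by auto
    then show ?thesis using assms by linarith
  qed
  then show "e \<in> all_edges {..<n}"
    using e by (auto simp: all_edges_def)
qed

text \<open>
  The single edge of a shorter path would be the demand edge itself, which lies inside a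
  triangle and so is not a crossing edge. Lengths count vertices here.
\<close>

lemma crossing_path_length:
  assumes "distinct p" "p \<noteq> []" "path_edges p \<subseteq> crossing_edges m"
    "{hd p, last p} \<in> triangle_edges m"
  shows "length p \<ge> 3"
proof (rule ccontr)
  assume "\<not> length p \<ge> 3"
  with assms(2) consider x where "p = [x]" | x y where "p = [x, y]"
    by (cases p rule: remdups_adj.cases; cases "tl (tl p)") auto
  then show False
  proof cases
    case 1
    then show False
      using assms(4) by (auto simp: triangle_edges_def all_edges_def)
  next
    case 2
    then have "{x, y} \<in> crossing_edges m" "{x, y} \<in> triangle_edges m"
      using assms(3,4) by (auto simp: path_edges_Cons path_edges_singleton)
    then show False
      by (auto dest!: triangle_edges_constant_div
          simp: crossing_edges_def edges_across_def all_edges_def)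
  qed
qed

text \<open>
  The middle vertex of the path determines the second triangle, and both edges join it to the
  triangle that contains the two ends. This is why paths with two edges consume the edges
  between two triangles in pairs.
\<close>

lemma crossing_two_path:
  assumes "length p = 3" "path_edges p \<subseteq> crossing_edges m"
    "{hd p, last p} \<in> triangle_edges m"
  shows "\<exists>P\<in>all_edges {..<m}. path_edges p \<subseteq> edges_across P"
proof -
  obtain u x v where p: "p = [u, x, v]"
    using assms(1) by (auto simp: length_Suc_conv numeral_3_eq_3)
  have eq: "u div 3 = v div 3"
    using triangle_edges_constant_div[OF assms(3)] p by auto
  have pe: "path_edges p = {{u, x}, {x, v}}"
    by (simp add: p path_edges_Cons path_edges_singleton)
  obtain P where P: "P \<in> all_edges {..<m}" "{u, x} \<in> edges_across P"
    using assms(2) pe by (auto simp: crossing_edges_def)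
  have "{x, v} \<in> crossing_edges m"
    using assms(2) pe by auto
  then have "{x, v} \<in> edges_across P"
    using P(2) eq by (auto simp: crossing_edges_def edges_across_def insert_commute)
  then show ?thesis
    using P pe by auto
qed

text \<open>
  The paths are split into those that leave the set of crossing edges, which are injectively
  charged to edges outside this set, and the good ones that stay inside. The parity argument
  bounds the number of good paths with two edges by four for each pair of triangles. The
  inequality is written without subtraction: the number of edges outside the crossing ones is
  \<open>(n choose 2) - 9 * (m choose 2)\<close>, and three times this number plus \<open>13 * (m choose 2)\<close> bounds
  three times the number of demand edges.
\<close>

lemma triangle_demand_bound:
  assumes real: "realizable (complete_graph n) (repeat_mset k (mset_set (triangle_edges m)))"
    and "3 * m \<le> n"
  shows "9 * m * k + 14 * (m choose 2) \<le> 3 * (n choose 2)"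
proof -
  define N where "N = k * (3 * m)"
  define X where "X = crossing_edges m"
  obtain p where p: "\<And>i. i < N \<Longrightarrow> is_path (complete_graph n) (p i)"
    "\<And>i. i < N \<Longrightarrow> {hd (p i), last (p i)} \<in> triangle_edges m"
    "disjoint_family_on (\<lambda>i. path_edges (p i)) {..<N}"
  proof -
    have size: "size (repeat_mset k (mset_set (triangle_edges m))) = N"
      by (simp add: card_triangle_edges N_def)
    have "e \<in> triangle_edges m" if "e \<in># repeat_mset k (mset_set (triangle_edges m))" for e
      using in_repeat_msetD[OF that] by (simp add: finite_triangle_edges)
    then show thesis
      using that realizableE[OF real, unfolded size] by metis
  qed
  have path: "distinct (p i)" "p i \<noteq> []" "path_edges (p i) \<subseteq> all_edges {..<n}" if "i < N" for i
    using p(1)[OF that] by (auto simp: is_path_def complete_graph_def)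
  have disj: "disjoint_family_on (\<lambda>i. path_edges (p i)) J" if "J \<subseteq> {..<N}" for J
    using p(3) that by (auto simp: disjoint_family_on_def)
  define Good where "Good = {i\<in>{..<N}. path_edges (p i) \<subseteq> X}"
  define Short where "Short = {i\<in>Good. length (p i) = 3}"
  have fin: "finite Good" "finite Short" "Good \<subseteq> {..<N}" "Short \<subseteq> Good"
    by (auto simp: Good_def Short_def)
  have long: "length (p i) \<ge> 3" if "i \<in> Good" for i
    using that by (intro crossing_path_length[of _ m]) (auto simp: Good_def X_def path p(2))

  have bad: "card ({..<N} - Good) + 9 * (m choose 2) \<le> (n choose 2)"
  proof -
    let ?B = "all_edges {..<n} - X"
    have "card ({..<N} - Good) = (\<Sum>i\<in>{..<N} - Good. 1)"
      by simp
    also have "\<dots> \<le> (\<Sum>i\<in>{..<N} - Good. card (path_edges (p i) \<inter> ?B))"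
    proof (rule sum_mono)
      fix i assume "i \<in> {..<N} - Good"
      then have "path_edges (p i) \<inter> ?B \<noteq> {}"
        using path(3)[of i] by (auto simp: Good_def)
      then show "1 \<le> card (path_edges (p i) \<inter> ?B)"
        by (simp add: Suc_le_eq card_gt_0_iff finite_path_edges)
    qed
    also have "\<dots> \<le> card ?B"
      using disj[of "{..<N} - Good"]
      by (intro sum_card_disjoint_le) (auto simp: finite_all_edges disjoint_family_on_def)
    finally have 1: "card ({..<N} - Good) \<le> card ?B" .
    have sub: "X \<subseteq> all_edges {..<n}"
      unfolding X_def using assms(2) by (rule crossing_edges_subset)
    have "card ?B + card X = card (all_edges {..<n})"
      using sub card_mono[OF _ sub]
      by (simp add: card_Diff_subset finite_subset[OF sub] finite_all_edges)
    then show ?thesis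
      using 1 by (simp add: X_def card_crossing_edges card_all_edges)
  qed

  have short: "card Short \<le> 4 * (m choose 2)"
  proof -
    define S where "S P = {i\<in>Short. path_edges (p i) \<subseteq> edges_across P}" for P
    have "Short \<subseteq> (\<Union>P\<in>all_edges {..<m}. S P)"
    proof
      fix i assume i: "i \<in> Short"
      then have "\<exists>P\<in>all_edges {..<m}. path_edges (p i) \<subseteq> edges_across P"
        by (intro crossing_two_path) (auto simp: Short_def Good_def X_def p(2))
      then show "i \<in> (\<Union>P\<in>all_edges {..<m}. S P)"
        using i by (auto simp: S_def)
    qed
    then have "card Short \<le> card (\<Union>P\<in>all_edges {..<m}. S P)"
      by (intro card_mono) (auto simp: finite_all_edges S_def fin)
    also have "\<dots> \<le> (\<Sum>P\<in>all_edges {..<m}. card (S P))"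
      by (intro card_UN_le finite_all_edges) simp
    also have "\<dots> \<le> (\<Sum>P\<in>all_edges {..<m}. 4)"
    proof (rule sum_mono)
      fix P assume P: "P \<in> all_edges {..<m}"
      have "2 * card (S P) = (\<Sum>i\<in>S P. card (path_edges (p i)))"
        by (simp add: S_def Short_def Good_def card_path_edges path)
      also have "\<dots> \<le> card (edges_across P)"
        using fin P by (intro sum_card_disjoint_le disj)
          (auto simp: S_def Short_def Good_def finite_edges_across_pair)
      \<comment> \<open>Here parity enters: twice a number is at most nine, hence at most eight.\<close>
      finally show "card (S P) \<le> 4"
        using card_edges_across_pair[OF P] by simp
    qed
    finally show ?thesis
      by (simp add: card_all_edges)
  qed

  have good: "3 * card Good \<le> 9 * (m choose 2) + card Short"
  proof -
    have "3 * card Good = (\<Sum>i\<in>Good. 3)"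
      by simp
    \<comment> \<open>Every good path has three edges, up to a deficit of one that only short paths have.\<close>
    also have "\<dots> \<le> (\<Sum>i\<in>Good. card (path_edges (p i)) + of_bool (length (p i) = 3))"
    proof (rule sum_mono)
      fix i assume i: "i \<in> Good"
      then show "3 \<le> card (path_edges (p i)) + of_bool (length (p i) = 3)"
        using long[OF i] path(1)[of i] by (auto simp: card_path_edges Good_def)
    qed
    also have "\<dots> = (\<Sum>i\<in>Good. card (path_edges (p i))) + card Short"
      using fin by (simp add: sum.distrib Short_def Int_def)
    also have "(\<Sum>i\<in>Good. card (path_edges (p i))) \<le> card X"
      using fin by (intro sum_card_disjoint_le disj)
        (auto simp: Good_def X_def finite_crossing_edges)
    finally show ?thesis
      by (simp add: X_def card_crossing_edges)
  qed

  have "card Good + card ({..<N} - Good) = N"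
    using card_Diff_subset[of Good "{..<N}"] card_mono[of "{..<N}" Good] fin by simp
  then have "3 * N + 14 * (m choose 2) \<le> 3 * (n choose 2)"
    using good short bad by linarith
  then show ?thesis
    by (simp add: N_def mult_ac)
qed

section \<open>The bound on the maximum degree\<close>

lemma bounded_demandsI:
  assumes "n > 0" "\<And>e. e \<in># D \<Longrightarrow> e \<in> all_edges {..<n}" "\<And>v. degree D v \<le> q"
  shows "D \<in> bounded_demands n q"
proof -
  have "max_degree {..<n} D \<le> q"
    unfolding max_degree_def using assms by (intro Max.boundedI) auto
  then show ?thesis
    using assms(2) by (auto simp: bounded_demands_def demand_multigraphs_def complete_graph_def)
qed

lemma triangle_demand_degree:
  "degree (repeat_mset k (mset_set (triangle_edges m))) v \<le> 2 * k"
proof -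
  let ?t = "triangle (v div 3)"
  have "{e \<in> triangle_edges m. v \<in> e} \<subseteq> (\<lambda>w. {v, w}) ` (?t - {v})"
    by (fastforce simp: triangle_edges_def all_edges_def card_2_iff triangle_def)
  then have "card {e \<in> triangle_edges m. v \<in> e} \<le> card (?t - {v})"
    by (rule surj_card_le[rotated]) (simp add: finite_triangle)
  also have "\<dots> = 2"
    using card_triangle[of "v div 3"] by (simp add: card_Diff_singleton triangle_def)
  finally have "k * card {e \<in> triangle_edges m. v \<in> e} \<le> k * 2"
    by (rule mult_le_mono2)
  moreover have "filter_mset (\<lambda>e. v \<in> e) (repeat_mset k M) = repeat_mset k (filter_mset (\<lambda>e. v \<in> e) M)"
    for M :: "nat set multiset"
    by (rule multiset_eqI) simp
  ultimately show ?thesis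
    by (simp add: degree_def filter_mset_mset_set finite_triangle_edges mult.commute)
qed

theorem theorem1p1:
  "\<exists>C::real. \<forall>n q::nat. n \<ge> 2 \<longrightarrow>
     terminal_pairable (complete_graph n) (bounded_demands n q) \<longrightarrow>
     real q \<le> 13 / 27 * real n + C"
  \<comment> \<open>The error terms below add up to less than 7; the constant 10 is not optimized.\<close>
proof (intro exI[of _ 10] allI impI)
  fix n q :: nat
  assume n: "n \<ge> 2" and pairable: "terminal_pairable (complete_graph n) (bounded_demands n q)"
  define m k where "m = n div 3" and "k = q div 2"
  show "real q \<le> 13 / 27 * real n + 10"
  proof (cases "m = 0")
    case True
    \<comment> \<open>There is no triangle on two vertices; parallel copies of the only edge bound \<open>q\<close> instead.\<close>
    then have "n = 2" using n by (simp add: m_def)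
    have "replicate_mset q {0, 1} \<in> bounded_demands n q"
      using n by (intro bounded_demandsI) 
        (auto simp: all_edges_def degree_def split: if_splits
          intro: size_filter_mset_lesseq[THEN order_trans])
    then have "realizable ({..<n}, all_edges {..<n}) (replicate_mset q {0, 1})"
      using pairable by (simp add: terminal_pairable_def complete_graph_def)
    then have "q \<le> card (all_edges {..<n})"
      by (rule realizable_size_le[THEN order_trans[rotated]]) (auto simp: finite_all_edges split: if_splits)
    then have "q \<le> 1"
      by (simp add: card_all_edges \<open>n = 2\<close>)
    then show ?thesis by simp
  next
    case False
    define D where "D = repeat_mset k (mset_set (triangle_edges m))"
    have "D \<in> bounded_demands n q"
    proof (rule bounded_demandsI)
      fix e assume "e \<in># D"
      then obtain t where t: "t < m" "e \<in> all_edges (triangle t)"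
        by (auto dest!: in_repeat_msetD simp: D_def finite_triangle_edges)
           (auto simp: triangle_edges_def)
      moreover have "triangle t \<subseteq> {..<n}"
        using t(1) by (auto simp: triangle_eq m_def)
      ultimately show "e \<in> all_edges {..<n}"
        by (auto simp: all_edges_def)
    next
      show "degree D v \<le> q" for v
        using triangle_demand_degree[of k m v] by (simp add: D_def k_def)
    qed (use n in simp)
    then have "realizable (complete_graph n) D"
      using pairable by (simp add: terminal_pairable_def)
    then have "9 * m * k + 14 * (m choose 2) \<le> 3 * (n choose 2)"
      unfolding D_def by (rule triangle_demand_bound) (simp add: m_def)
    then have "real (9 * m * k + 14 * (m choose 2)) \<le> real (3 * (n choose 2))"
      by (rule of_nat_mono)
    moreover have choose2: "real (j choose 2) = real j * (real j - 1) / 2" for j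
      by (cases j) (auto simp: choose_two real_of_nat_div field_simps)
    ultimately have main: "9 * real m * real k + 7 * real m * (real m - 1)
        \<le> 3 / 2 * real n * (real n - 1)"
      by (simp add: choose2)
    have "real n \<le> 3 * real m + 2"
      unfolding m_def by linarith
    then have "real n * (real n - 1) \<le> (3 * real m + 2) * (3 * real m + 1)"
      using n by (intro mult_mono) auto
    then have "9 * real m * real k \<le> 13 / 2 * real m * real m + 41 / 2 * real m + 3"
      using main by (simp add: algebra_simps)
    also have "\<dots> \<le> real m * (13 / 2 * real m + 47 / 2)"
      using False by (simp add: algebra_simps)
    finally have "real m * (9 * real k) \<le> real m * (13 / 2 * real m + 47 / 2)"
      by (simp add: mult_ac)
    then have "9 * real k \<le> 13 / 2 * real m + 47 / 2"
      using False by (subst (asm) mult_le_cancel_left_pos) auto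
    moreover have "real q \<le> 2 * real k + 1" "3 * real m \<le> real n"
      unfolding k_def m_def by linarith+
    ultimately show ?thesis by linarith
  qed
qed

end
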